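(* Let $z\in[0,1)^2$. The sequence $(T^k(z))_{k\in\mathbb Z}$ is periodic if and only if $z\in\mathcal R$ or $S^n(z)\in\mathcal P$ for some $n\ge0$.
   Context: Let $\gamma=\frac{1+\sqrt5}2$, and let $\{u\}=u-\lfloor u\rfloor$ denote the fractional part. $T:[0,1)^2\to[0,1)^2$ is the bijection $T(x,y)=(y,\{-x+y/\gamma\})$. The sequence $(T^k(z))_{k\in\mathbb Z}$ is periodic if $T^p(z)=z$ for some $p\ge1$. Put $\mathcal R=\{(x,y)\in[0,1)^2:\ y<\gamma x,\ x+y>1,\ x<\gamma y\}\cup\{(0,0)\}$ and $\mathcal D=[0,1)^2\setminus\mathcal R$. Write $\mathcal D/\gamma^2=\{z/\gamma^2:z\in\mathcal D\}$. Let $\mathcal P$ be the set of points of $\mathcal D$ which are not eventually mapped to $\mathcal D/\gamma^2$, i.e. of $z\in\mathcal D$ with $T^m(z)\notin\mathcal D/\gamma^2$ for all $m\ge0$; explicitly $\mathcal P=D_\alpha\cup T(D_\alpha)\cup D_\beta\cup T(D_\beta)\cup T^2(D_\beta)$, where $D_\alpha=\{(x,y)\in[0,1)^2\setminus\{(0,0)\}:\ y\ge\gamma x,\ y\ge1/\gamma^2,\ x+y\le1,\ y\le(1+x)/\gamma\}$ and $D_\beta=\{z/\gamma^2:z\in\mathcal R\setminus\{(0,0)\}\}$. For $z\in\mathcal D\setminus\mathcal P$ let $s(z)=\min\{m\ge0:T^m(z)\in\mathcal D/\gamma^2\}$, and define $S:\mathcal D\setminus\mathcal P\to\mathcal D$,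 $S(z)=\gamma^2T^{s(z)}(z)$. For $z\in\mathcal D$, $S^0(z)=z$ and $S^n(z)=S(S^{n-1}(z))$ is defined as long as $S^{n-1}(z)$ is defined and lies in $\mathcal D\setminus\mathcal P$; the condition "$S^n(z)\in\mathcal P$" includes that $z\in\mathcal D$ and $S^n(z)$ is defined. *)

theory Defs
  imports "HOL-Analysis.Analysis"
begin

definition golden :: real  (\<open>\<gamma>\<close>)
  where "\<gamma> = (1 + sqrt 5) / 2"

definition unit_square :: "(real \<times> real) set"
  where "unit_square = {0..<1} \<times> {0..<1}"

text \<open>A total function on the plane; only its restriction to \<^const>\<open>unit_square\<close> matters.\<close>

fun T :: "real \<times> real \<Rightarrow> real \<times> real"
  where "T (x, y) = (y, frac (- x + y / \<gamma>))"

lemma T_bij: "bij_betw T unit_square unit_square"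
proof (rule bij_betw_byWitness[where f' = "\<lambda>(u, v). (frac (u / \<gamma> - v), u)"])
  have cancel: "frac (a - frac (a - x)) = x" if "0 \<le> x" "x < 1" for a x :: real
  proof -
    have "a - frac (a - x) = x + of_int \<lfloor>a - x\<rfloor>"
      by (simp add: frac_def)
    then show ?thesis
      using that by (simp add: frac_unique_iff)
  qed
  show "\<forall>z\<in>unit_square. (case T z of (u, v) \<Rightarrow> (frac (u / \<gamma> - v), u)) = z"
    by (auto simp: unit_square_def cancel)
  show "\<forall>z\<in>unit_square. T (case z of (u, v) \<Rightarrow> (frac (u / \<gamma> - v), u)) = z"
    by (auto simp: unit_square_def cancel)
qed (auto simp: unit_square_def frac_lt_1)

text \<open>Since \<open>T\<close> is a bijection of the unit square, returning to \<open>z\<close> once makes the whole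
  two-sided orbit of \<open>z\<close> periodic.\<close>

definition orbit_periodic :: "real \<times> real \<Rightarrow> bool"
  where "orbit_periodic z \<longleftrightarrow> (\<exists>p\<ge>1. (T ^^ p) z = z)"

definition \<R> :: "(real \<times> real) set"
  where "\<R> = {(x, y) \<in> unit_square. y < \<gamma> * x \<and> x + y > 1 \<and> x < \<gamma> * y} \<union> {(0, 0)}"

definition \<D> :: "(real \<times> real) set"
  where "\<D> = unit_square - \<R>"

definition \<D>_scaled :: "(real \<times> real) set"
  where "\<D>_scaled = (\<lambda>z. z /\<^sub>R \<gamma>\<^sup>2) ` \<D>"

definition \<P> :: "(real \<times> real) set"
  where "\<P> = {z \<in> \<D>. \<forall>m. (T ^^ m) z \<notin> \<D>_scaled}"

definition hit_time :: "real \<times> real \<Rightarrow> nat"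
  where "hit_time z = (LEAST m. (T ^^ m) z \<in> \<D>_scaled)"

text \<open>\<open>S\<close> is meaningful only on \<open>\<D> - \<P>\<close>, where \<^const>\<open>hit_time\<close> is a genuine minimum.\<close>

definition S :: "real \<times> real \<Rightarrow> real \<times> real"
  where "S z = \<gamma>\<^sup>2 *\<^sub>R (T ^^ hit_time z) z"

lemma S_in_D:
  assumes "z \<in> \<D> - \<P>"
  shows "S z \<in> \<D>"
proof -
  from assms have "\<exists>m. (T ^^ m) z \<in> \<D>_scaled"
    by (auto simp: \<P>_def)
  then have "(T ^^ hit_time z) z \<in> \<D>_scaled"
    unfolding hit_time_def by (rule LeastI_ex)
  then obtain w where "w \<in> \<D>" "(T ^^ hit_time z) z = w /\<^sub>R \<gamma>\<^sup>2"
    by (auto simp: \<D>_scaled_def)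
  moreover have "\<gamma> > 0"
    by (simp add: golden_def add_pos_pos)
  ultimately show ?thesis
    by (simp add: S_def)
qed

text \<open>The partial iterates of \<open>S\<close>; \<^const>\<open>None\<close> stands for ``undefined''.\<close>

fun S_iter :: "nat \<Rightarrow> real \<times> real \<Rightarrow> (real \<times> real) option"
  where
    "S_iter 0 z = (if z \<in> \<D> then Some z else None)"
  | "S_iter (Suc n) z =
      (case S_iter n z of
         None \<Rightarrow> None
       | Some w \<Rightarrow> if w \<in> \<D> - \<P> then Some (S w) else None)"

end

theory Submission
  imports Defs
begin

text \<open>
  The linear part \<open>A (x, y) = (y, y / \<gamma> - x)\<close> of \<^const>\<open>T\<close> has trace \<open>1 / \<gamma> = 2 cos (2 \<pi> / 5)\<close>
  and determinant \<open>1\<close>, hence \<open>A\<^sup>5 = 1\<close>, and \<^const>\<open>T\<close> is \<open>A\<close> on the \<^emph>\<open>upper\<close> part \<open>\<gamma> x \<le> y\<close> of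
  the square and \<open>A + (0, 1)\<close> on the remaining lower part. On \<^const>\<open>\<R>\<close> without the origin, an affinely
  regular pentagon, every step is a lower one, so there \<^const>\<open>T\<close> is a single affine map of order
  five (\<open>R_period_five\<close>). As \<^const>\<open>T\<close> is injective, the complement \<^const>\<open>\<D>\<close> is invariant as well.

  On \<^const>\<open>\<D>\<close> the map is self-similar. Write \<open>U\<close> for division by \<open>\<gamma>\<^sup>2\<close>. For an upper
  \<open>w \<in> \<D>\<close> one has \<open>T (U w) = U (T w)\<close>. For a lower \<open>w \<in> \<D>\<close> the point \<open>U w\<close> makes six steps,
  of types lower, upper, lower, lower, upper, lower, and because \<open>A\<^sup>6 = A\<close> it arrives exactly at \<open>U (T w)\<close>;
  the five points in between lie outside \<open>U \<D>\<close> (\<open>funpow_T_shrink_lower\<close>). Thus the first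
  return map of \<^const>\<open>T\<close> to \<open>U \<D>\<close> is a copy of \<^const>\<open>T\<close> on \<^const>\<open>\<D>\<close>, with return times one and six.

  Consequently a point \<open>w\<close> of \<^const>\<open>\<D>\<close> is periodic if and only if \<open>U w\<close> is. Moreover the period gets strictly
  smaller when one passes from \<open>U w\<close> to \<open>w\<close>, since an orbit in \<^const>\<open>\<D>\<close> cannot make two upper steps
  in a row and so some return takes six steps (\<open>shrink_period_descent\<close>). For \<open>z \<in> \<D> - \<P>\<close>
  the points \<open>z\<close> and \<open>U (S z)\<close> lie on one orbit. So \<open>z\<close> is periodic if and only if \<open>S z\<close> is, and the
  period of \<open>S z\<close> is the smaller one: a periodic \<open>z\<close> cannot be renormalised for ever and must reach
  \<^const>\<open>\<P>\<close>.

  It remains to see that every point of \<^const>\<open>\<P>\<close> is periodic (\<open>P_periodic\<close>). An orbit in \<^const>\<open>\<D>\<close>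
  cannot make three lower steps in a row either, so it suffices to follow the orbit of an upper point. At most
  five steps show that it either hits \<open>U \<D>\<close>, or visits the image under \<open>U\<close> of the pentagon, where
  \<^const>\<open>T\<close> has period fifteen, or lies in a second pentagon, where \<^const>\<open>T\<close> has period ten.
\<close>

section \<open>Arithmetic with the golden ratio\<close>

lemma golden_mult_self: "\<gamma> * \<gamma> = \<gamma> + 1"
  by (simp add: golden_def field_simps)

lemma golden_lower: "8 / 5 < \<gamma>" and golden_upper: "\<gamma> < 5 / 3"
proof -
  have "11 / 5 < sqrt 5"
    by (rule real_less_rsqrt) (simp add: power2_eq_square)
  then show "8 / 5 < \<gamma>"
    by (simp add: golden_def)
  have "sqrt 5 < 7 / 3"
    by (rule real_less_lsqrt) (simp_all add: power2_eq_square)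
  then show "\<gamma> < 5 / 3"
    by (simp add: golden_def)
qed

lemmas golden_bounds = golden_lower golden_upper

lemma golden_mult_left: "\<gamma> * (\<gamma> * a) = \<gamma> * a + a"
  using golden_mult_self by (simp add: mult.assoc [symmetric] distrib_right)

text \<open>
  Inequalities below are linear over \<open>\<rat>(\<gamma>)\<close>. Expanding with these rules turns them into linear
  inequalities over \<open>\<rat>\<close> in \<open>\<gamma>\<close>, \<open>x\<close>, \<open>\<gamma> x\<close>, \<open>y\<close>, \<open>\<gamma> y\<close>; what linear arithmetic then misses are
  hypotheses multiplied by positive elements of \<open>\<rat>(\<gamma>)\<close>, which the proofs supply by hand.
\<close>

lemmas golden_simps = algebra_simps golden_mult_self golden_mult_left

lemma divide_golden: "a / \<gamma> = (\<gamma> - 1) * a"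
  using golden_bounds by (simp add: field_simps golden_mult_left)

lemma golden_le_iff: "\<gamma> * a \<le> b \<longleftrightarrow> a \<le> (\<gamma> - 1) * b"
  unfolding divide_golden [symmetric]
  using golden_lower by (subst pos_le_divide_eq) (simp_all add: mult.commute)

lemma less_golden_iff: "b < \<gamma> * a \<longleftrightarrow> (\<gamma> - 1) * b < a"
  using golden_le_iff [of a b] by (simp add: not_le [symmetric])

section \<open>The map on the unit square\<close>

text \<open>
  Along an orbit written as a sequence of coordinates, \<open>T (a\<^sub>i, a\<^sub>i\<^sub>+\<^sub>1) = (a\<^sub>i\<^sub>+\<^sub>1, a\<^sub>i\<^sub>+\<^sub>2)\<close>, each step
  reduces by this rule to \<open>0 \<le> a\<^sub>i\<^sub>+\<^sub>2 < 1\<close> and a congruence modulo \<open>1\<close>.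
\<close>

lemma T_eqI:
  assumes "0 \<le> v" "v < 1" "v = (\<gamma> - 1) * y - x + of_int k"
  shows "T (x, y) = (y, v)"
proof -
  have "frac (- x + y / \<gamma>) = v"
    using assms by (simp add: frac_unique_iff divide_golden)
  then show ?thesis
    by simp
qed

declare T.simps [simp del]

lemmas funpow_numeral =
  eval_nat_numeral BitM.simps numeral_One One_nat_def funpow.simps o_apply id_apply

lemma T_in_unit_square: "z \<in> unit_square \<Longrightarrow> T z \<in> unit_square"
  using T_bij by (rule bij_betwE [THEN bspec])

lemma funpow_T_in_unit_square: "z \<in> unit_square \<Longrightarrow> (T ^^ m) z \<in> unit_square"
  using bij_betw_funpow [OF T_bij] by (rule bij_betwE [THEN bspec])

lemma funpow_T_commute: "(T ^^ m) ((T ^^ n) z) = (T ^^ n) ((T ^^ m) z)"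
  by (metis add.commute comp_apply funpow_add)

text \<open>
  By injectivity on the square, all points of an orbit have the same periods, also those that
  come before the point at which periodicity is observed.
\<close>

lemma funpow_T_eq_iff:
  assumes "z \<in> unit_square"
  shows "(T ^^ p) ((T ^^ m) z) = (T ^^ m) z \<longleftrightarrow> (T ^^ p) z = z"
proof
  assume "(T ^^ p) ((T ^^ m) z) = (T ^^ m) z"
  then have "(T ^^ m) ((T ^^ p) z) = (T ^^ m) z"
    by (simp add: funpow_T_commute)
  moreover have "inj_on (T ^^ m) unit_square"
    using bij_betw_funpow [OF T_bij] by (rule bij_betw_imp_inj_on)
  ultimately show "(T ^^ p) z = z"
    using assms funpow_T_in_unit_square by (blast dest: inj_onD)
qed (simp add: funpow_T_commute [of p])

lemma orbit_periodic_funpow_iff: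
  "z \<in> unit_square \<Longrightarrow> orbit_periodic ((T ^^ m) z) \<longleftrightarrow> orbit_periodic z"
  by (simp add: orbit_periodic_def funpow_T_eq_iff)

lemma T_lower:
  assumes "x \<in> {0..<1}" "y \<in> {0..<1}" "y < \<gamma> * x"
  shows "T (x, y) = (y, (\<gamma> - 1) * y - x + 1)"
proof (rule T_eqI [where k = 1])
  have "0 \<le> (\<gamma> - 1) * y"
    using assms golden_bounds by simp
  then show "0 \<le> (\<gamma> - 1) * y - x + 1"
    using assms by simp
  show "(\<gamma> - 1) * y - x + 1 < 1"
    using assms(3) by (simp add: less_golden_iff)
qed simp

lemma T_upper:
  assumes "x \<in> {0..<1}" "y \<in> {0..<1}" "\<gamma> * x \<le> y"
  shows "T (x, y) = (y, (\<gamma> - 1) * y - x)"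
proof (rule T_eqI [where k = 0])
  show "0 \<le> (\<gamma> - 1) * y - x"
    using assms(3) by (simp add: golden_le_iff)
  have "(\<gamma> - 1) * y \<le> 1 * y"
    using assms golden_bounds by (intro mult_right_mono) auto
  then show "(\<gamma> - 1) * y - x < 1"
    using assms by simp
qed simp

lemma T_origin: "T (0, 0) = (0, 0)"
  by (simp add: T.simps)

section \<open>The pentagon of period five\<close>

definition pentagon :: "(real \<times> real) set"
  where "pentagon = \<R> - {(0, 0)}"

lemma pentagon_iff:
  "(x, y) \<in> pentagon \<longleftrightarrow>
    x \<in> {0..<1} \<and> y \<in> {0..<1} \<and> (\<gamma> - 1) * y - x < 0 \<and> 1 < x + y \<and> (\<gamma> - 1) * x - y < 0"
  by (auto simp: pentagon_def \<R>_def unit_square_def less_golden_iff)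

text \<open>
  The five sides of the pentagon are \<open>b\<^sub>i < 1\<close> for five consecutive coordinates \<open>b\<^sub>0 = x\<close>,
  \<open>b\<^sub>1 = y\<close>, \<open>b\<^sub>2\<close>, \<open>b\<^sub>3\<close>, \<open>b\<^sub>4\<close> of an orbit that makes only lower steps. Since \<open>b\<^sub>5 = b\<^sub>0\<close>, the map
  permutes these conditions cyclically.
\<close>

lemma T_pentagon:
  assumes "(x, y) \<in> pentagon"
  shows "T (x, y) = (y, (\<gamma> - 1) * y - x + 1)" and "(y, (\<gamma> - 1) * y - x + 1) \<in> pentagon"
proof -
  note * = assms [unfolded pentagon_iff]
  show "T (x, y) = (y, (\<gamma> - 1) * y - x + 1)"
    using * by (intro T_lower) (auto simp: less_golden_iff)
  have "0 < (\<gamma> - 1) * (x + y - 1)" "0 \<le> (\<gamma> - 1) * y" "0 < \<gamma> * (y - (\<gamma> - 1) * x)" "0 < (\<gamma> - 1) * (1 - x)"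
    using * golden_bounds by simp_all
  then show "(y, (\<gamma> - 1) * y - x + 1) \<in> pentagon"
    using * golden_bounds by (auto simp: pentagon_iff golden_simps)
qed

lemma pentagon_orbit:
  assumes "(x, y) \<in> pentagon"
  shows "(T ^^ 3) (x, y) = (\<gamma> - (\<gamma> - 1) * (x + y), 1 + (\<gamma> - 1) * x - y)" (is ?three)
    and "(T ^^ 5) (x, y) = (x, y)" (is ?five)
proof -
  let ?b2 = "(\<gamma> - 1) * y - x + 1"
    and ?b3 = "\<gamma> - (\<gamma> - 1) * (x + y)" and ?b4 = "1 + (\<gamma> - 1) * x - y"
  have 0: "T (x, y) = (y, ?b2)" and p1: "(y, ?b2) \<in> pentagon"
    using T_pentagon [OF assms] by auto
  have 1: "T (y, ?b2) = (?b2, ?b3)" and p2: "(?b2, ?b3) \<in> pentagon"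
    using T_pentagon [OF p1] by (auto simp: golden_simps)
  have 2: "T (?b2, ?b3) = (?b3, ?b4)" and p3: "(?b3, ?b4) \<in> pentagon"
    using T_pentagon [OF p2] by (auto simp: golden_simps)
  have 3: "T (?b3, ?b4) = (?b4, x)" and p4: "(?b4, x) \<in> pentagon"
    using T_pentagon [OF p3] by (auto simp: golden_simps)
  have 4: "T (?b4, x) = (x, y)"
    using T_pentagon [OF p4] by (auto simp: golden_simps)
  show ?three ?five
    by (simp_all only: funpow_numeral 0 1 2 3 4)
qed

lemma T_R: "z \<in> \<R> \<Longrightarrow> T z \<in> \<R>"
  using T_pentagon T_origin by (cases z) (auto simp: pentagon_def \<R>_def)

lemma R_period_five: "z \<in> \<R> \<Longrightarrow> (T ^^ 5) z = z"
  using pentagon_orbit(2) [of "fst z" "snd z"]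
  by (cases "z = (0, 0)") (auto simp: pentagon_def T_origin eval_nat_numeral)

text \<open>
  A point mapped into \<^const>\<open>\<R>\<close> is itself in \<^const>\<open>\<R>\<close>: it has period five together with its image,
  so it is reached again from that image after four steps inside \<^const>\<open>\<R>\<close>.
\<close>

lemma T_D:
  assumes "z \<in> \<D>"
  shows "T z \<in> \<D>"
proof -
  have z: "z \<in> unit_square" "z \<notin> \<R>"
    using assms by (auto simp: \<D>_def)
  have "T z \<notin> \<R>"
  proof
    assume R: "T z \<in> \<R>"
    have "(T ^^ 5) z = z"
      using R_period_five [OF R] funpow_T_eq_iff [OF z(1), of 5 1] by simp
    moreover have "(T ^^ 4) (T z) = (T ^^ 5) z"
      using funpow_add [of 4 1 T] by simp
    moreover have "(T ^^ m) (T z) \<in> \<R>" for m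
      by (induction m) (use R T_R in auto)
    ultimately show False
      using z(2) by metis
  qed
  then show ?thesis
    using T_in_unit_square [OF z(1)] by (simp add: \<D>_def)
qed

lemma funpow_T_D: "z \<in> \<D> \<Longrightarrow> (T ^^ m) z \<in> \<D>"
  by (induction m) (simp_all add: T_D)

section \<open>Self-similarity: the first return to the scaled copy\<close>

abbreviation shrink :: "real \<times> real \<Rightarrow> real \<times> real"
  where "shrink z \<equiv> z /\<^sub>R \<gamma>\<^sup>2"

definition upper :: "(real \<times> real) set"
  where "upper = {(x, y). \<gamma> * x \<le> y}"

lemma golden_square_inverse: "inverse (\<gamma>\<^sup>2) = 2 - \<gamma>"
proof (rule inverse_unique)
  show "\<gamma>\<^sup>2 * (2 - \<gamma>) = 1"
    by (simp add: power2_eq_square golden_simps)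
qed

lemma shrink_pair: "shrink (x, y) = ((2 - \<gamma>) * x, (2 - \<gamma>) * y)"
  by (simp add: golden_square_inverse)

lemma shrink_golden_square: "shrink ((\<gamma> + 1) * x, (\<gamma> + 1) * y) = (x, y)"
  unfolding shrink_pair by (simp add: golden_simps)

lemma shrink_eq_iff: "shrink z = shrink w \<longleftrightarrow> z = w"
  using golden_lower by simp

lemma D_iff:
  "(x, y) \<in> \<D> \<longleftrightarrow> x \<in> {0..<1} \<and> y \<in> {0..<1} \<and> (x, y) \<noteq> (0, 0) \<and>
    (\<gamma> * x \<le> y \<or> x + y \<le> 1 \<or> \<gamma> * y \<le> x)"
  by (auto simp: \<D>_def \<R>_def unit_square_def)

lemma shrink_in_box:
  assumes "x \<in> {0..<1}" "y \<in> {0..<1}"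
  shows "(2 - \<gamma>) * x \<in> {0..<2 - \<gamma>}" "(2 - \<gamma>) * y \<in> {0..<2 - \<gamma>}"
  using assms golden_bounds by (auto simp: mult_less_cancel_left2)

lemma D_scaled_less:
  assumes "(u, v) \<in> \<D>_scaled"
  shows "u < 2 - \<gamma>" "v < 2 - \<gamma>"
proof -
  obtain x y where "(x, y) \<in> \<D>" "(u, v) = shrink (x, y)"
    using assms by (auto simp: \<D>_scaled_def)
  then show "u < 2 - \<gamma>" "v < 2 - \<gamma>"
    using shrink_in_box [of x y] unfolding shrink_pair by (auto simp: D_iff)
qed

text \<open>
  \<open>{0..<2 - \<gamma>} \<times> {0..<2 - \<gamma>}\<close> is the square divided by \<open>\<gamma>\<^sup>2\<close>, as \<open>1 / \<gamma>\<^sup>2 = 2 - \<gamma>\<close>.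
\<close>

lemma box_cases:
  assumes "x \<in> {0..<2 - \<gamma>}" "y \<in> {0..<2 - \<gamma>}" "(x, y) \<noteq> (0, 0)"
  obtains "(x, y) \<in> \<D>_scaled" | "(x, y) \<in> shrink ` pentagon"
proof -
  define w where "w = ((\<gamma> + 1) * x, (\<gamma> + 1) * y)"
  have xy: "(x, y) = shrink w"
    by (simp only: w_def shrink_golden_square)
  have "(\<gamma> + 1) * t \<in> {0..<1}" if "t \<in> {0..<2 - \<gamma>}" for t
  proof -
    have "(\<gamma> + 1) * t < (\<gamma> + 1) * (2 - \<gamma>)"
      using that golden_bounds by (intro mult_strict_left_mono) auto
    then show ?thesis
      using that golden_bounds by (simp add: golden_simps)
  qed
  then have "w \<in> unit_square"
    using assms by (simp add: w_def unit_square_def)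
  moreover have "w \<noteq> (0, 0)"
    using assms(3) golden_bounds by (auto simp: w_def)
  ultimately consider "w \<in> \<D>" | "w \<in> pentagon"
    by (auto simp: \<D>_def pentagon_def)
  then show thesis
    using that xy unfolding \<D>_scaled_def by cases blast+
qed

text \<open>
  The condition defining \<^const>\<open>upper\<close> is homogeneous, and \<^const>\<open>T\<close> is linear on this part.
\<close>

lemma T_shrink_upper:
  assumes "w \<in> \<D>" "w \<in> upper"
  shows "T (shrink w) = shrink (T w)"
proof -
  obtain x y where w: "w = (x, y)" and x: "x \<in> {0..<1}" and y: "y \<in> {0..<1}" and le: "\<gamma> * x \<le> y"
    using assms by (cases w) (auto simp: D_iff upper_def)
  have "(2 - \<gamma>) * (\<gamma> * x) \<le> (2 - \<gamma>) * y"
    using le golden_bounds by (intro mult_left_mono) auto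
  then have "\<gamma> * ((2 - \<gamma>) * x) \<le> (2 - \<gamma>) * y"
    by (simp add: ac_simps)
  moreover have "{0..<2 - \<gamma>} \<subseteq> {0..<1}"
    using golden_bounds by auto
  ultimately have "T ((2 - \<gamma>) * x, (2 - \<gamma>) * y) =
      ((2 - \<gamma>) * y, (\<gamma> - 1) * ((2 - \<gamma>) * y) - (2 - \<gamma>) * x)"
    using shrink_in_box [OF x y] by (intro T_upper) blast+
  then show ?thesis
    unfolding w T_upper [OF x y le] shrink_pair by (simp add: golden_simps)
qed

text \<open>
  The first three steps from \<open>U w\<close> are common to all lower \<open>w\<close>, in the pentagon or not; only at
  \<open>(a3, a4)\<close> does the difference between the two appear.
\<close>

lemma T_shrink_lower:
  assumes x: "x \<in> {0..<1}" and y: "y \<in> {0..<1}" and less: "y < \<gamma> * x"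
  defines "u \<equiv> (2 - \<gamma>) * x" and "v \<equiv> (2 - \<gamma>) * y"
  defines "a2 \<equiv> (\<gamma> - 1) * v - u + 1"
    and "a3 \<equiv> (\<gamma> - 1) * (1 - u - v)"
    and "a4 \<equiv> 2 - \<gamma> + (\<gamma> - 1) * u - v"
  shows "T (u, v) = (v, a2)" "T (v, a2) = (a2, a3)" "T (a2, a3) = (a3, a4)"
    and "\<gamma> - 1 \<le> a2" "a2 < 1" "0 \<le> a3" "a3 < 1" "0 \<le> a4" "a4 < 1"
proof -
  have uv: "0 \<le> u" "u < 2 - \<gamma>" "0 \<le> v" "v < 2 - \<gamma>"
    using shrink_in_box [OF x y] by (auto simp: u_def v_def)
  have "(2 - \<gamma>) * ((\<gamma> - 1) * y) < (2 - \<gamma>) * x"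
    using less golden_bounds by (intro mult_strict_left_mono) (auto simp: less_golden_iff)
  then have uv': "(\<gamma> - 1) * v < u"
    by (simp add: u_def v_def ac_simps)
  have nonneg: "0 \<le> (\<gamma> - 1) * u" "0 \<le> (\<gamma> - 1) * v" "0 \<le> (\<gamma> - 1) * (1 - u - v)"
    "(\<gamma> - 1) * u \<le> (\<gamma> - 1) * (2 - \<gamma>)"
    using uv golden_bounds by (auto intro: mult_left_mono)
  show a2: "\<gamma> - 1 \<le> a2" "a2 < 1"
    using uv uv' nonneg golden_bounds by (auto simp: a2_def golden_simps)
  show a3: "0 \<le> a3" "a3 < 1"
    using uv nonneg golden_bounds by (auto simp: a3_def golden_simps)
  show a4: "0 \<le> a4" "a4 < 1"
    using uv nonneg golden_bounds by (auto simp: a4_def golden_simps)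
  show "T (u, v) = (v, a2)"
    using a2 golden_bounds by (intro T_eqI [where k = 1]) (auto simp: a2_def)
  show "T (v, a2) = (a2, a3)"
    using a3 by (intro T_eqI [where k = 0]) (auto simp: a2_def a3_def golden_simps)
  show "T (a2, a3) = (a3, a4)"
    using a4 by (intro T_eqI [where k = 1]) (auto simp: a2_def a3_def a4_def golden_simps)
qed

text \<open>
  Membership of \<open>w\<close> in \<^const>\<open>\<D>\<close> is what keeps the orbit away from the scaled copy: \<open>x + y \<le> 1\<close>
  forces \<open>a3 \<ge> 1 / \<gamma>\<^sup>2\<close>, and \<open>\<gamma> y \<le> x\<close> forces \<open>a4 \<ge> 1 / \<gamma>\<^sup>2\<close>. Each of the other intermediate
  points has \<open>a2\<close> or \<open>a5\<close> as a coordinate, and these are at least \<open>1 / \<gamma>\<close>.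
\<close>

lemma funpow_T_shrink_lower:
  assumes "w \<in> \<D>" "w \<notin> upper"
  shows "(T ^^ 6) (shrink w) = shrink (T w)"
    and "m \<in> {1..5} \<Longrightarrow> (T ^^ m) (shrink w) \<notin> \<D>_scaled"
proof -
  obtain x y where w: "w = (x, y)" and x: "x \<in> {0..<1}" and y: "y \<in> {0..<1}"
    and less: "y < \<gamma> * x" and D: "x + y \<le> 1 \<or> \<gamma> * y \<le> x"
    using assms by (cases w) (auto simp: D_iff upper_def)
  define u where "u = (2 - \<gamma>) * x"
  define v where "v = (2 - \<gamma>) * y"
  define a2 where "a2 = (\<gamma> - 1) * v - u + 1"
  define a3 where "a3 = (\<gamma> - 1) * (1 - u - v)"
  define a4 where "a4 = 2 - \<gamma> + (\<gamma> - 1) * u - v"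
  define a5 where "a5 = u + \<gamma> - 1"
  define a7 where "a7 = (\<gamma> - 1) * v - u + 2 - \<gamma>"
  have uv: "0 \<le> u" "u < 2 - \<gamma>" "0 \<le> v" "v < 2 - \<gamma>"
    using shrink_in_box [OF x y] by (auto simp: u_def v_def)
  note T012 = T_shrink_lower(1-3) [OF x y less, folded u_def v_def, folded a2_def a3_def a4_def]
  note bounds = T_shrink_lower(4-9) [OF x y less, folded u_def v_def, folded a2_def a3_def a4_def]
  have T3: "T (a3, a4) = (a4, a5)"
    using uv golden_bounds
    by (intro T_eqI [where k = 1]) (auto simp: a3_def a4_def a5_def golden_simps)
  have T4: "T (a4, a5) = (a5, v)"
    using uv golden_bounds
    by (intro T_eqI [where k = 0]) (auto simp: a4_def a5_def golden_simps)
  have T5: "T (a5, v) = (v, a7)"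
    using uv bounds(1,2) golden_bounds
    by (intro T_eqI [where k = 1]) (auto simp: a2_def a5_def a7_def)
  have sw: "shrink w = (u, v)"
    unfolding w shrink_pair u_def v_def ..
  have sTw: "shrink (T w) = (v, a7)"
    unfolding w T_lower [OF x y less] shrink_pair u_def v_def a7_def by (simp add: golden_simps)
  note orbit = funpow_numeral T012 T3 T4 T5
  show "(T ^^ 6) (shrink w) = shrink (T w)"
    unfolding sw sTw by (simp only: orbit)
  have a34: "2 - \<gamma> \<le> a3 \<or> 2 - \<gamma> \<le> a4"
    using D
  proof
    assume "x + y \<le> 1"
    then have "(2 - \<gamma>) * (x + y) \<le> (2 - \<gamma>) * 1"
      using golden_bounds by (intro mult_left_mono) auto
    then have "(\<gamma> - 1) * (\<gamma> - 1) \<le> (\<gamma> - 1) * (1 - u - v)"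
      using golden_bounds by (intro mult_left_mono) (auto simp: u_def v_def algebra_simps)
    then show ?thesis
      by (simp add: a3_def golden_simps)
  next
    assume "\<gamma> * y \<le> x"
    then have "(2 - \<gamma>) * y \<le> (2 - \<gamma>) * ((\<gamma> - 1) * x)"
      using golden_bounds by (intro mult_left_mono) (auto simp: golden_le_iff)
    then show ?thesis
      by (simp add: a4_def u_def v_def algebra_simps)
  qed
  show "(T ^^ m) (shrink w) \<notin> \<D>_scaled" if "m \<in> {1..5}"
  proof
    assume hit: "(T ^^ m) (shrink w) \<in> \<D>_scaled"
    have "m = 1 \<or> m = 2 \<or> m = 3 \<or> m = 4 \<or> m = 5"
      using that by auto
    then have "(v, a2) \<in> \<D>_scaled \<or> (a2, a3) \<in> \<D>_scaled \<or> (a3, a4) \<in> \<D>_scaled \<or>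
        (a4, a5) \<in> \<D>_scaled \<or> (a5, v) \<in> \<D>_scaled"
      using hit unfolding sw by (elim disjE) (simp_all only: orbit simp_thms)
    moreover have "2 - \<gamma> \<le> a2" "2 - \<gamma> \<le> a5"
      using bounds(1) uv golden_bounds by (auto simp: a5_def)
    ultimately show False
      using a34 by (auto dest: D_scaled_less)
  qed
qed

section \<open>Points that avoid the scaled copy\<close>

text \<open>
  The orbit of a point of the shrunk pentagon returns there after three steps, and this third iterate,
  enlarged by \<open>\<gamma>\<^sup>2\<close>, is \<open>T\<^sup>3\<close> on the pentagon: both have linear part \<open>A\<^sup>3\<close> and fix the centre.
\<close>

lemma funpow_T_shrink_pentagon:
  assumes "w \<in> pentagon"
  shows "(T ^^ 3) (shrink w) = shrink ((T ^^ 3) w)"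
proof -
  obtain x y where w: "w = (x, y)"
    by (cases w)
  note p = assms [unfolded w]
  have x: "x \<in> {0..<1}" and y: "y \<in> {0..<1}" and less: "y < \<gamma> * x"
    using p by (auto simp: pentagon_iff less_golden_iff)
  show ?thesis
    unfolding w pentagon_orbit(1) [OF p] shrink_pair
    by (simp only: funpow_numeral
          T_shrink_lower(1-3) [OF x y less])
      (simp add: golden_simps)
qed

lemma shrink_pentagon_periodic:
  assumes "z \<in> shrink ` pentagon"
  shows "orbit_periodic z"
proof -
  obtain w where w: "w \<in> pentagon" and z: "z = shrink w"
    using assms by blast
  have orbit: "(T ^^ m) w \<in> pentagon" for m
  proof (induction m)
    case (Suc m)
    then show ?case
      using T_pentagon by (cases "(T ^^ m) w") auto
  qed (simp add: w)
  have "(T ^^ (3 * n)) (shrink w) = shrink ((T ^^ (3 * n)) w)" for n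
  proof (induction n)
    case (Suc n)
    have "(T ^^ (3 * Suc n)) v = (T ^^ 3) ((T ^^ (3 * n)) v)" for v
      by (simp only: mult_Suc_right funpow_add o_apply)
    then show ?case
      using funpow_T_shrink_pentagon [OF orbit] by (simp only: Suc.IH)
  qed simp
  from this [of 5] have "(T ^^ 15) z = shrink ((T ^^ 15) w)"
    by (simp add: z)
  also have "(T ^^ 15) w = (T ^^ 5) ((T ^^ 5) ((T ^^ 5) w))"
    using funpow_add [of 10 5 T] funpow_add [of 5 5 T] by (simp del: funpow.simps)
  also have "\<dots> = w"
    using w R_period_five by (simp add: pentagon_def)
  finally show ?thesis
    unfolding orbit_periodic_def z by (intro exI [of _ 15]) simp
qed

text \<open>
  With \<open>b2\<close> the next coordinate, the second and the third lower step say \<open>1 < x + y\<close> and \<open>(\<gamma> - 1) x < y\<close>: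
  the remaining two sides of the pentagon, which \<^const>\<open>\<D>\<close> excludes.
\<close>

lemma not_lower_thrice:
  assumes "w \<in> \<D>" "w \<notin> upper" "T w \<notin> upper"
  shows "T (T w) \<in> upper"
proof (rule ccontr)
  assume TT: "T (T w) \<notin> upper"
  obtain x y where w: "w = (x, y)" and x: "x \<in> {0..<1}" and y: "y \<in> {0..<1}"
    and less: "y < \<gamma> * x"
    using assms by (cases w) (auto simp: D_iff upper_def)
  define b2 where "b2 = (\<gamma> - 1) * y - x + 1"
  have Tw: "T w = (y, b2)"
    unfolding w T_lower [OF x y less] b2_def ..
  have b2: "b2 \<in> {0..<1}" "b2 < \<gamma> * y"
    using T_D [OF assms(1)] assms(3) unfolding Tw by (auto simp: D_iff upper_def)
  have "(\<gamma> - 1) * b2 - y + 1 < \<gamma> * b2"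
    using TT unfolding Tw T_lower [OF y b2] by (simp add: upper_def)
  then have "\<gamma> * (y - (\<gamma> - 1) * x) > 0"
    by (simp add: b2_def golden_simps)
  then have "(\<gamma> - 1) * x < y"
    using golden_lower by (simp add: zero_less_mult_iff)
  moreover have "1 < x + y"
    using b2(2) by (simp add: b2_def golden_simps)
  ultimately have "(x, y) \<in> pentagon"
    using x y less by (simp add: pentagon_iff less_golden_iff)
  then show False
    using assms(1) w by (simp add: pentagon_def \<D>_def)
qed

text \<open>
  The region is the closed pentagon given by \<open>0 \<le> a\<^sub>i\<close> for the even coordinates \<open>a\<^sub>0 = x\<close>, \<open>a\<^sub>2\<close>,
  \<open>a\<^sub>4\<close>, \<open>a\<^sub>6\<close>, \<open>a\<^sub>8\<close> of an orbit that makes upper and lower steps alternately; the odd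
  coordinates are \<open>a\<^sub>i = a\<^sub>i\<^sub>+\<^sub>5 + 1 / \<gamma>\<^sup>2\<close>. Two steps permute the five sides cyclically.
\<close>

lemma period_ten:
  assumes "0 \<le> x" "\<gamma> * x \<le> y" "2 - \<gamma> \<le> y" "x + y \<le> 1" "y \<le> (\<gamma> - 1) * (1 + x)"
  shows "(T ^^ 10) (x, y) = (x, y)"
proof -
  let ?a2 = "(\<gamma> - 1) * y - x"
  let ?a4 = "(\<gamma> - 1) * (1 + x) - y"
  let ?a6 = "y - (2 - \<gamma>)"
  let ?a8 = "(\<gamma> - 1) * (1 - x - y)"
  let ?a3 = "?a8 + (2 - \<gamma>)"
  let ?a5 = "x + (2 - \<gamma>)"
  let ?a7 = "?a2 + (2 - \<gamma>)"
  let ?a9 = "?a4 + (2 - \<gamma>)"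
  have le: "x \<le> (\<gamma> - 1) * y"
    using assms(2) by (simp add: golden_le_iff)
  have y: "0 \<le> y"
    using assms(3) golden_upper by linarith
  have y1: "y < 1"
  proof (rule ccontr)
    assume "\<not> y < 1"
    then show False
      using assms(1,4,5) golden_upper by (cases "x = 0") auto
  qed
  have "(\<gamma> - 1) * x \<le> (\<gamma> - 1) * ((\<gamma> - 1) * y)" "0 \<le> (\<gamma> - 1) * x" "0 \<le> (\<gamma> - 1) * y"
    "(\<gamma> - 1) * y < \<gamma> - 1" "0 \<le> (\<gamma> - 1) * (1 - x - y)"
    using assms(1,4) y y1 le golden_bounds by (auto intro: mult_left_mono simp: mult_less_cancel_left2)
  note bounds = this assms(1,3-5) le y y1 golden_bounds
  have "1 * y < \<gamma> * y"
    using assms(3) golden_bounds by (intro mult_strict_right_mono) auto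
  then have "\<gamma> * x < x + y"
    using bounds(1) by (simp add: golden_simps)
  moreover have "0 < (\<gamma> - 1) * (x + y)"
    using assms(1,3) golden_bounds by (intro mult_pos_pos) auto
  ultimately have strict: "\<gamma> * x < x + y" "0 < (\<gamma> - 1) * (x + y)"
    by blast+
  note bounds = strict bounds
  have
    "T (x, y) = (y, ?a2)" "T (?a2, ?a3) = (?a3, ?a4)" "T (?a4, ?a5) = (?a5, ?a6)"
    "T (?a6, ?a7) = (?a7, ?a8)" "T (?a8, ?a9) = (?a9, x)"
    using bounds by (intro T_eqI [where k = 0]; simp add: golden_simps)+
  moreover have
    "T (y, ?a2) = (?a2, ?a3)" "T (?a3, ?a4) = (?a4, ?a5)" "T (?a5, ?a6) = (?a6, ?a7)"
    "T (?a7, ?a8) = (?a8, ?a9)" "T (?a9, x) = (x, y)"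
    using bounds by (intro T_eqI [where k = 1]; simp add: golden_simps)+
  ultimately show ?thesis
    by (simp only: funpow_numeral)
qed

lemma box_hits_or_periodic:
  assumes "x \<in> {0..<2 - \<gamma>}" "y \<in> {0..<2 - \<gamma>}" "(x, y) \<noteq> (0, 0)"
  shows "(x, y) \<in> \<D>_scaled \<or> orbit_periodic (x, y)"
  using box_cases [OF assms] shrink_pentagon_periodic by metis

text \<open>
  Outside the small square and the region of \<open>period_ten\<close>, an upper point \<open>z\<close> has \<open>x + y > 1\<close> or
  \<open>y > (1 + x) / \<gamma>\<close>. Then either \<open>T\<^sup>2 z\<close> or \<open>T\<^sup>5 z\<close> is a nonzero point of the small square, which
  consists, apart from the origin, of \<open>U \<D>\<close> and the shrunk pentagon.
\<close>

lemma upper_hits_or_periodic: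
  assumes "z \<in> \<D>" "z \<in> upper"
  shows "(\<exists>m. (T ^^ m) z \<in> \<D>_scaled) \<or> orbit_periodic z"
proof -
  obtain x y where z: "z = (x, y)" and x: "x \<in> {0..<1}" and y: "y \<in> {0..<1}"
    and nz: "(x, y) \<noteq> (0, 0)" and upper: "\<gamma> * x \<le> y"
    using assms by (cases z) (auto simp: D_iff upper_def)
  have z_sq: "z \<in> unit_square"
    using assms(1) by (simp add: \<D>_def)
  have le: "x \<le> (\<gamma> - 1) * y"
    using upper by (simp add: golden_le_iff)
  have boxI: ?thesis
    if "(T ^^ m) z = (u, v)" "u \<in> {0..<2 - \<gamma>}" "v \<in> {0..<2 - \<gamma>}" "(u, v) \<noteq> (0, 0)" for m u v
    using box_hits_or_periodic [OF that(2-4)] orbit_periodic_funpow_iff [OF z_sq, of m] that(1) by metis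
  define a2 where "a2 = (\<gamma> - 1) * y - x"
  define a3 where "a3 = 1 - (\<gamma> - 1) * (x + y)"
  have "(\<gamma> - 1) * x \<le> (\<gamma> - 1) * ((\<gamma> - 1) * y)" "0 \<le> (\<gamma> - 1) * x" "0 \<le> (\<gamma> - 1) * y"
    "(\<gamma> - 1) * y < \<gamma> - 1"
    using x y le golden_bounds by (auto intro: mult_left_mono simp: mult_less_cancel_left2)
  note bounds = this x y le golden_bounds
  have T0: "T (x, y) = (y, a2)"
    unfolding a2_def by (rule T_upper [OF x y upper])
  have pos: "0 < (\<gamma> - 1) * (x + y)"
    using x y nz golden_bounds by (intro mult_pos_pos) auto
  have a3: "0 < a3" "a3 < 1"
    using bounds pos by (auto simp: a3_def golden_simps)
  have T1: "T (y, a2) = (a2, a3)"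
    using a3 by (intro T_eqI [where k = 1]) (auto simp: a2_def a3_def golden_simps)
  \<comment> \<open>Gives \<open>y\<close> the lower bound needed in the last case also when \<open>x + y > 1\<close>.\<close>
  have steep: "(\<gamma> - 1) * (1 + x) < y" if "1 < x + y" "2 - \<gamma> \<le> a2"
  proof -
    have "0 < x"
      using that(1) y by auto
    moreover have "\<gamma> * (2 - \<gamma>) \<le> \<gamma> * a2"
      using that(2) golden_lower by (intro mult_left_mono) auto
    ultimately show ?thesis
      by (simp add: a2_def golden_simps)
  qed
  consider "y < 2 - \<gamma>" | "2 - \<gamma> \<le> y" "x + y \<le> 1" "y \<le> (\<gamma> - 1) * (1 + x)"
    | "1 < x + y" "a2 < 2 - \<gamma>" | "(\<gamma> - 1) * (1 + x) < y" "x + y \<le> 1 \<or> 2 - \<gamma> \<le> a2"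
    using steep by (meson linorder_not_le)
  then show ?thesis
  proof cases
    case 1
    have "(\<gamma> - 1) * y \<le> 1 * y"
      using y golden_bounds by (intro mult_right_mono) auto
    then show ?thesis
      using 1 x y nz le by (intro boxI [of 0 x y]) (auto simp: z)
  next
    case 2
    then have "(T ^^ 10) z = z"
      using x upper unfolding z by (intro period_ten) auto
    then show ?thesis
      unfolding orbit_periodic_def by (intro disjI2 exI [of _ 10]) simp
  next
    case 3
    have "(\<gamma> - 1) * 1 < (\<gamma> - 1) * (x + y)"
      using 3 golden_bounds by (intro mult_strict_left_mono) auto
    then have "a3 < 2 - \<gamma>"
      by (simp add: a3_def)
    then show ?thesis
      using 3 a3 le T0 T1 by (intro boxI [of 2 a2 a3]) (auto simp: z a2_def eval_nat_numeral)
  next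
    case 4
    \<comment> \<open>Here \<open>y > (1 + x) / \<gamma>\<close> turns the third step into a lower one.\<close>
    define a4 where "a4 = \<gamma> + (\<gamma> - 1) * x - y"
    have x_less: "x < 2 - \<gamma>"
      using 4(2)
    proof
      assume "x + y \<le> 1"
      then have "\<gamma> * x < 2 - \<gamma>"
        using 4(1) by (simp add: golden_simps)
      moreover have "1 * x \<le> \<gamma> * x"
        using x golden_lower by (intro mult_right_mono) auto
      ultimately show ?thesis
        by simp
    next
      assume "2 - \<gamma> \<le> a2"
      then show ?thesis
        using bounds unfolding a2_def by linarith
    qed
    have T2: "T (a2, a3) = (a3, a4)"
      using bounds 4(1) by (intro T_eqI [where k = 1]) (auto simp: a2_def a3_def a4_def golden_simps)
    have T3: "T (a3, a4) = (a4, x)"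
      using bounds by (intro T_eqI [where k = 0]) (auto simp: a3_def a4_def golden_simps)
    have T4: "T (a4, x) = (x, y - (\<gamma> - 1))"
      using bounds 4(1) by (intro T_eqI [where k = 1]) (auto simp: a4_def golden_simps)
    have "(T ^^ 5) z = (x, y - (\<gamma> - 1))"
      by (simp only: z funpow_numeral T0 T1 T2 T3 T4)
    then show ?thesis
      using bounds 4(1) x_less by (intro boxI [of 5 x "y - (\<gamma> - 1)"]) (auto simp: golden_simps)
  qed
qed

lemma P_periodic:
  assumes "z \<in> \<P>"
  shows "orbit_periodic z"
proof -
  have z: "z \<in> \<D>" "z \<in> unit_square" and avoid: "(T ^^ m) z \<notin> \<D>_scaled" for m
    using assms by (auto simp: \<P>_def \<D>_def)
  obtain j where j: "(T ^^ j) z \<in> upper"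
  proof (cases "z \<in> upper \<or> T z \<in> upper")
    case True
    then show thesis
      using that [of 0] that [of 1] by auto
  next
    case False
    then show thesis
      using not_lower_thrice [OF z(1)] that [of 2] by (auto simp: eval_nat_numeral)
  qed
  have "(T ^^ m) ((T ^^ j) z) \<notin> \<D>_scaled" for m
    using avoid [of "m + j"] by (simp add: funpow_add)
  then have "orbit_periodic ((T ^^ j) z)"
    using upper_hits_or_periodic [OF funpow_T_D [OF z(1)] j] by blast
  then show ?thesis
    using z(2) by (simp add: orbit_periodic_funpow_iff)
qed

section \<open>Descent on the period\<close>

text \<open>
  The \<open>k\<close>-th return of \<open>U w\<close> to \<open>U \<D>\<close> happens at \<open>U (T\<^sup>k w)\<close>. The bound \<open>k \<le> n\<close> makes
  the time \<open>n\<close> positive when \<open>k\<close> is, as a period has to be.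
\<close>

lemma shrink_funpow_T:
  assumes "w \<in> \<D>"
  obtains n where "k \<le> n" "(T ^^ n) (shrink w) = shrink ((T ^^ k) w)"
proof -
  have "\<exists>n\<ge>k. (T ^^ n) (shrink w) = shrink ((T ^^ k) w)"
  proof (induction k)
    case (Suc k)
    then obtain n where n: "k \<le> n" "(T ^^ n) (shrink w) = shrink ((T ^^ k) w)"
      by blast
    have D: "(T ^^ k) w \<in> \<D>"
      using assms by (rule funpow_T_D)
    obtain t where t: "1 \<le> t" "(T ^^ t) (shrink ((T ^^ k) w)) = shrink (T ((T ^^ k) w))"
    proof (cases "(T ^^ k) w \<in> upper")
      case True
      then show thesis
        using T_shrink_upper [OF D] that [of 1] by simp
    next
      case False
      then show thesis
        using funpow_T_shrink_lower(1) [OF D] that [of 6] by simp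
    qed
    then have "(T ^^ (t + n)) (shrink w) = shrink ((T ^^ Suc k) w)"
      by (simp only: funpow_add funpow.simps o_apply n)
    moreover have "Suc k \<le> t + n"
      using n(1) t(1) by simp
    ultimately show ?case
      by blast
  qed (auto intro: exI [of _ 0])
  then show thesis
    using that by blast
qed

lemma orbit_periodic_shrink:
  assumes "w \<in> \<D>" "orbit_periodic w"
  shows "orbit_periodic (shrink w)"
proof -
  obtain p where p: "1 \<le> p" "(T ^^ p) w = w"
    using assms(2) by (auto simp: orbit_periodic_def)
  obtain n where "p \<le> n" "(T ^^ n) (shrink w) = shrink w"
    using shrink_funpow_T [OF assms(1), of p] p(2) by metis
  then show ?thesis
    using p(1) by (auto simp: orbit_periodic_def intro!: exI [of _ n])
qed

text \<open>
  Conversely every visit to \<open>U \<D>\<close> is one of these returns. The \<open>k\<close>-th comes no earlier than at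
  time \<open>k\<close>, and at time \<open>k\<close> only if every return took a single step.
\<close>

lemma return_to_D_scaled:
  assumes "w \<in> \<D>" "(T ^^ p) (shrink w) \<in> \<D>_scaled"
  obtains k where "(T ^^ p) (shrink w) = shrink ((T ^^ k) w)" "k \<le> p" "0 < p \<Longrightarrow> 0 < k"
    "k = p \<Longrightarrow> \<forall>i<k. (T ^^ i) w \<in> upper"
proof -
  have "\<exists>k\<le>p. (T ^^ p) (shrink w) = shrink ((T ^^ k) w) \<and> (0 < p \<longrightarrow> 0 < k) \<and>
      (k = p \<longrightarrow> (\<forall>i<k. (T ^^ i) w \<in> upper))"
    using assms
  proof (induction p arbitrary: w rule: less_induct)
    case (less p)
    have TD: "T w \<in> \<D>"
      using less.prems(1) by (rule T_D)
    show ?case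
    proof (cases "p = 0")
      case False
      show ?thesis
      proof (cases "w \<in> upper")
        case True
        obtain q where q: "p = Suc q"
          using False by (cases p) auto
        have step: "(T ^^ p) (shrink w) = (T ^^ q) (shrink (T w))"
          unfolding q funpow_Suc_right o_apply T_shrink_upper [OF less.prems(1) True] ..
        obtain k where k: "k \<le> q" "(T ^^ q) (shrink (T w)) = shrink ((T ^^ k) (T w))"
          "k = q \<Longrightarrow> \<forall>i<k. (T ^^ i) (T w) \<in> upper"
          using less.IH [OF _ TD, of q] less.prems(2) unfolding step by (auto simp: q)
        have "(T ^^ i) w \<in> upper" if "k = q" "i < Suc k" for i
          using k(3) that True by (cases i) (auto simp: funpow_swap1)
        then show ?thesis
          using k step by (intro exI [of _ "Suc k"]) (auto simp: q funpow_swap1)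
      next
        case lower: False
        have "p \<notin> {1..5}"
          using funpow_T_shrink_lower(2) [OF less.prems(1) lower] less.prems(2) by blast
        then obtain q where q: "p = q + 6"
          using False that [of "p - 6"] by auto
        have step: "(T ^^ p) (shrink w) = (T ^^ q) (shrink (T w))"
          unfolding q funpow_add o_apply funpow_T_shrink_lower(1) [OF less.prems(1) lower] ..
        obtain k where k: "k \<le> q" "(T ^^ q) (shrink (T w)) = shrink ((T ^^ k) (T w))"
          using less.IH [OF _ TD, of q] less.prems(2) unfolding step by (auto simp: q)
        then show ?thesis
          using step by (intro exI [of _ "Suc k"]) (auto simp: q funpow_swap1)
      qed
    qed auto
  qed
  then show thesis
    using that by blast
qed

text \<open>
  Two upper steps in a row would give \<open>\<gamma> y \<le> y / \<gamma> - x\<close>, that is \<open>x + y \<le> 0\<close>.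
\<close>

lemma not_upper_twice:
  assumes "w \<in> \<D>" "w \<in> upper"
  shows "T w \<notin> upper"
proof
  assume T: "T w \<in> upper"
  obtain x y where w: "w = (x, y)" and x: "x \<in> {0..<1}" and y: "y \<in> {0..<1}"
    and nz: "(x, y) \<noteq> (0, 0)" and le: "\<gamma> * x \<le> y"
    using assms by (cases w) (auto simp: D_iff upper_def)
  have "\<gamma> * y \<le> (\<gamma> - 1) * y - x"
    using T unfolding w T_upper [OF x y le] by (simp add: upper_def)
  then have "x + y \<le> 0"
    by (simp add: algebra_simps)
  then show False
    using x y nz by auto
qed

text \<open>
  Equality of the two periods would make the whole cycle of \<open>w\<close> upper; even if \<open>w\<close> is a fixed point,
  this means two upper steps in a row.
\<close>

lemma shrink_period_descent:
  assumes "w \<in> \<D>" "1 \<le> p" "(T ^^ p) (shrink w) = shrink w"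
  obtains k where "1 \<le> k" "k < p" "(T ^^ k) w = w"
proof -
  have "(T ^^ p) (shrink w) \<in> \<D>_scaled"
    using assms(1) unfolding assms(3) \<D>_scaled_def by (rule imageI)
  then obtain k where k: "shrink w = shrink ((T ^^ k) w)" "k \<le> p" "0 < k"
    "k = p \<Longrightarrow> \<forall>i<k. (T ^^ i) w \<in> upper"
    using return_to_D_scaled [OF assms(1), of p] assms(2) unfolding assms(3) by auto
  have per: "(T ^^ k) w = w"
    using k(1) unfolding shrink_eq_iff by (rule sym)
  have "k \<noteq> p"
  proof
    assume "k = p"
    then have up: "\<forall>i<k. (T ^^ i) w \<in> upper"
      by (rule k(4))
    then have "w \<in> upper"
      using k(3) by force
    moreover have "T w \<in> upper"
    proof (cases "k = 1")
      case True
      then show ?thesis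
        using per \<open>w \<in> upper\<close> by simp
    next
      case False
      then show ?thesis
        using up [rule_format, of 1] k(3) by simp
    qed
    ultimately show False
      using not_upper_twice [OF assms(1)] by blast
  qed
  then show thesis
    using that [of k] k per by simp
qed

lemma shrink_S:
  assumes "z \<in> \<D> - \<P>"
  shows "shrink (S z) = (T ^^ hit_time z) z"
  using golden_lower by (simp add: S_def)

text \<open>
  \<^const>\<open>S_iter\<close> recurses at the far end of the orbit of \<^const>\<open>S\<close>; inductions on the number of
  renormalisations need to split off the first one instead.
\<close>

lemma S_iter_Suc:
  "z \<in> \<D> - \<P> \<Longrightarrow> S_iter (Suc n) z = S_iter n (S z)"
proof (induction n)
  case 0
  then show ?case
    using S_in_D by auto
next
  case (Suc n)
  have "S_iter (Suc (Suc n)) z =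
      (case S_iter (Suc n) z of None \<Rightarrow> None | Some w \<Rightarrow> if w \<in> \<D> - \<P> then Some (S w) else None)"
    by (rule S_iter.simps)
  then show ?case
    unfolding Suc.IH [OF Suc.prems] by simp
qed

lemma periodic_reaches_P:
  assumes "z \<in> \<D>" "1 \<le> p" "(T ^^ p) z = z"
  shows "\<exists>n. \<exists>w\<in>\<P>. S_iter n z = Some w"
  using assms
proof (induction p arbitrary: z rule: less_induct)
  case (less p)
  show ?case
  proof (cases "z \<in> \<P>")
    case True
    then show ?thesis
      using less.prems(1) by (intro exI [of _ 0]) auto
  next
    case False
    then have z: "z \<in> \<D> - \<P>" "z \<in> unit_square"
      using less.prems(1) by (auto simp: \<D>_def)
    have "(T ^^ p) (shrink (S z)) = shrink (S z)"
      unfolding shrink_S [OF z(1)] funpow_T_eq_iff [OF z(2)] by (rule less.prems(3))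
    then obtain k where "1 \<le> k" "k < p" "(T ^^ k) (S z) = S z"
      using shrink_period_descent [OF S_in_D [OF z(1)] less.prems(2)] by blast
    then obtain n where "\<exists>w\<in>\<P>. S_iter n (S z) = Some w"
      using less.IH S_in_D [OF z(1)] by blast
    then show ?thesis
      using S_iter_Suc [OF z(1), of n] by metis
  qed
qed

lemma S_iter_SomeD: "S_iter n z = Some w \<Longrightarrow> z \<in> \<D>"
  by (induction n arbitrary: w) (auto split: if_splits option.splits)

lemma reaches_P_periodic:
  assumes "S_iter n z = Some w" "w \<in> \<P>"
  shows "orbit_periodic z"
  using assms(1)
proof (induction n arbitrary: z)
  case 0
  then show ?case
    using assms(2) P_periodic by (auto split: if_splits)
next
  case (Suc n)
  have z: "z \<in> \<D>"
    using Suc.prems by (rule S_iter_SomeD)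
  show ?case
  proof (cases "z \<in> \<P>")
    case False
    then have z': "z \<in> \<D> - \<P>" "z \<in> unit_square"
      using z by (auto simp: \<D>_def)
    have "orbit_periodic (S z)"
      using Suc S_iter_Suc [OF z'(1)] by simp
    then have "orbit_periodic ((T ^^ hit_time z) z)"
      using orbit_periodic_shrink [OF S_in_D [OF z'(1)]] unfolding shrink_S [OF z'(1)] by blast
    then show ?thesis
      by (simp only: orbit_periodic_funpow_iff [OF z'(2)])
  qed (rule P_periodic)
qed

theorem theorem2p1:
  fixes z :: "real \<times> real"
  assumes "z \<in> unit_square"
  shows "orbit_periodic z \<longleftrightarrow> z \<in> \<R> \<or> (\<exists>n. \<exists>w\<in>\<P>. S_iter n z = Some w)"
proof
  assume "orbit_periodic z"
  then obtain p where "1 \<le> p" "(T ^^ p) z = z"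
    by (auto simp: orbit_periodic_def)
  then show "z \<in> \<R> \<or> (\<exists>n. \<exists>w\<in>\<P>. S_iter n z = Some w)"
    using periodic_reaches_P assms by (cases "z \<in> \<R>") (auto simp: \<D>_def)
next
  assume "z \<in> \<R> \<or> (\<exists>n. \<exists>w\<in>\<P>. S_iter n z = Some w)"
  then show "orbit_periodic z"
  proof
    assume "z \<in> \<R>"
    then show ?thesis
      using R_period_five unfolding orbit_periodic_def by (intro exI [of _ 5]) simp
  qed (blast dest: reaches_P_periodic)
qed

end
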